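(* If $G$ is an almost chordless graph with maximum degree three, then $G$ is 3-edge-colorable.
   Context: Graphs are finite and simple. An edge $xy$ of a graph is a chord of a cycle $Q$ if $x,y \in V(Q)$ but $xy$ is not an edge of $Q$. A graph is almost chordless if at most one of its edges is a chord of some cycle of the graph. A 3-edge-coloring is an assignment of colors from $\{1,2,3\}$ to edges such that adjacent (incident-sharing) edges receive distinct colors. *)

theory Defs
  imports Main
begin

text \<open>A graph is given by its vertex set and its set of edges, the edges being two-element sets
  of vertices.\<close>

definition fin_simple_graph :: "'a set \<Rightarrow> 'a set set \<Rightarrow> bool" where
  "fin_simple_graph V E \<longleftrightarrow> finite V \<and> E \<subseteq> {e. e \<subseteq> V \<and> card e = 2}"

definition vertex_degree :: "'a set set \<Rightarrow> 'a \<Rightarrow> nat" where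
  "vertex_degree E v = card {e \<in> E. v \<in> e}"

text \<open>Inserting 0 only matters for the graph without vertices, whose maximum degree is thus 0.\<close>

definition max_degree :: "'a set \<Rightarrow> 'a set set \<Rightarrow> nat" where
  "max_degree V E = Max (insert 0 (vertex_degree E ` V))"

text \<open>A cycle is represented by the list of its vertices in cyclic order, without repeating the
  first vertex at the end.\<close>

definition cycle_edges :: "'a list \<Rightarrow> 'a set set" where
  "cycle_edges q = {{q ! i, q ! (Suc i mod length q)} | i. i < length q}"

definition graph_cycle :: "'a set set \<Rightarrow> 'a list \<Rightarrow> bool" where
  "graph_cycle E q \<longleftrightarrow> 3 \<le> length q \<and> distinct q \<and> cycle_edges q \<subseteq> E"

definition is_chord :: "'a set set \<Rightarrow> 'a list \<Rightarrow> 'a set \<Rightarrow> bool" where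
  "is_chord E q e \<longleftrightarrow> e \<in> E \<and> e \<subseteq> set q \<and> e \<notin> cycle_edges q"

definition almost_chordless :: "'a set set \<Rightarrow> bool" where
  "almost_chordless E \<longleftrightarrow> (\<exists>\<^sub>\<le>\<^sub>1 e. \<exists>q. graph_cycle E q \<and> is_chord E q e)"

definition edge_coloring :: "nat \<Rightarrow> 'a set set \<Rightarrow> ('a set \<Rightarrow> nat) \<Rightarrow> bool" where
  "edge_coloring k E c \<longleftrightarrow>
     c ` E \<subseteq> {1..k} \<and> (\<forall>e\<in>E. \<forall>f\<in>E. e \<noteq> f \<and> e \<inter> f \<noteq> {} \<longrightarrow> c e \<noteq> c f)"

definition edge_colorable :: "nat \<Rightarrow> 'a set set \<Rightarrow> bool" where
  "edge_colorable k E \<longleftrightarrow> (\<exists>c. edge_coloring k E c)"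

end

theory Submission
  imports Defs
begin

text \<open>Induction on the number of edges, deleting one edge at a time; almost chordlessness passes to
  subgraphs. If the minimum degree is at least two, take a longest path \<open>p\<^sub>0 \<dots> p\<^sub>n\<close>. All neighbors
  of \<open>p\<^sub>0\<close> lie on it, so if \<open>p\<^sub>0\<close> has degree three, with neighbors \<open>p\<^sub>1, p\<^sub>i, p\<^sub>j\<close> and \<open>1 < i < j\<close>, then
  \<open>p\<^sub>0p\<^sub>i\<close> is a chord of the cycle \<open>p\<^sub>0 \<dots> p\<^sub>j\<close>; hence an end of a longest path has degree two unless it
  lies on the unique chord. If \<open>p\<^sub>0p\<^sub>j\<close> is an edge, reversing \<open>p\<^sub>0 \<dots> p\<^sub>j\<^sub>-\<^sub>1\<close> gives a longest path
  starting in \<open>p\<^sub>j\<^sub>-\<^sub>1\<close>, so for a suitable longest path \<open>p\<^sub>j\<close> has the two neighbors \<open>p\<^sub>0\<close> and \<open>p\<^sub>j\<^sub>-\<^sub>1\<close>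
  of degree two. Finally, if \<open>u\<close> has two neighbors \<open>v, w\<close> of degree two, a coloring of the graph
  without \<open>uv\<close> extends to \<open>uv\<close> after at most one Kempe change at \<open>u\<close>: a Kempe chain is a path or a
  cycle, so it cannot end in all of \<open>u, v, w\<close>.\<close>

section \<open>Degree bounds and paths\<close>

lemma vertex_degree_ge_2:
  assumes "finite E" "e \<in> E" "f \<in> E" "e \<noteq> f" "x \<in> e" "x \<in> f"
  shows "2 \<le> vertex_degree E x"
proof -
  have "card {e, f} \<le> vertex_degree E x"
    unfolding vertex_degree_def using assms by (intro card_mono) auto
  then show ?thesis using \<open>e \<noteq> f\<close> by simp
qed

lemma vertex_degree_ge_3:
  assumes "finite E" "{e, f, g} \<subseteq> E" "distinct [e, f, g]" "x \<in> e" "x \<in> f" "x \<in> g"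
  shows "3 \<le> vertex_degree E x"
proof -
  have "card {e, f, g} \<le> vertex_degree E x"
    unfolding vertex_degree_def using assms by (intro card_mono) auto
  then show ?thesis using assms(3) by simp
qed

definition path_in :: "'a set set \<Rightarrow> 'a list \<Rightarrow> bool" where
  "path_in E p \<longleftrightarrow> distinct p \<and> (\<forall>i. Suc i < length p \<longrightarrow> {p ! i, p ! Suc i} \<in> E)"

lemma path_in_rev:
  assumes "path_in E p"
  shows "path_in E (rev p)"
  unfolding path_in_def
proof (intro conjI allI impI)
  show "distinct (rev p)" using assms by (simp add: path_in_def)
  fix i assume i: "Suc i < length (rev p)"
  then have "{p ! (length p - Suc (Suc i)), p ! Suc (length p - Suc (Suc i))} \<in> E"
    using assms by (simp add: path_in_def)
  moreover have "Suc (length p - Suc (Suc i)) = length p - Suc i" using i by simp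
  ultimately show "{rev p ! i, rev p ! Suc i} \<in> E"
    using i by (simp add: rev_nth insert_commute)
qed

lemma path_in_append:
  assumes "path_in E p" "path_in E q" "set p \<inter> set q = {}"
    and "p \<noteq> [] \<Longrightarrow> q \<noteq> [] \<Longrightarrow> {last p, hd q} \<in> E"
  shows "path_in E (p @ q)"
  unfolding path_in_def
proof (intro conjI allI impI)
  show "distinct (p @ q)" using assms by (simp add: path_in_def)
  fix i assume i: "Suc i < length (p @ q)"
  consider "Suc i < length p" | "Suc i = length p" | "length p \<le> i" by linarith
  then show "{(p @ q) ! i, (p @ q) ! Suc i} \<in> E"
  proof cases
    case 1
    then show ?thesis using assms(1) by (simp add: path_in_def nth_append)
  next
    case 2
    then have "p \<noteq> []" "q \<noteq> []" using i by auto
    moreover have "last p = p ! i" "hd q = q ! 0"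
      using 2 \<open>p \<noteq> []\<close> \<open>q \<noteq> []\<close> by (auto simp: last_conv_nth hd_conv_nth simp flip: 2)
    ultimately show ?thesis using 2 assms(4) by (simp add: nth_append)
  next
    case 3
    then have "Suc (i - length p) < length q" using i by simp
    then show ?thesis using 3 assms(2) by (simp add: path_in_def nth_append Suc_diff_le)
  qed
qed

lemma path_in_take: "path_in E p \<Longrightarrow> path_in E (take n p)"
  by (simp add: path_in_def)

lemma path_in_drop: "path_in E p \<Longrightarrow> path_in E (drop n p)"
  by (simp add: path_in_def)

text \<open>Posa rotation: the edge from \<open>p ! 0\<close> to \<open>p ! j\<close> replaces the
  one from \<open>p ! (j - 1)\<close> to \<open>p ! j\<close>. The vertex set is kept, and the path
  now starts in \<open>p ! (j - 1)\<close>.\<close>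

lemma path_in_rotate:
  assumes "path_in E p" "0 < j" "j < length p" "{p ! 0, p ! j} \<in> E"
  shows "path_in E (rev (take j p) @ drop j p)"
proof (rule path_in_append)
  show "path_in E (rev (take j p))" "path_in E (drop j p)"
    using assms by (simp_all add: path_in_rev path_in_take path_in_drop)
  show "set (rev (take j p)) \<inter> set (drop j p) = {}"
    using assms(1) by (simp add: path_in_def set_take_disj_set_drop_if_distinct)
  have "take j p \<noteq> []" using assms by auto
  then show "{last (rev (take j p)), hd (drop j p)} \<in> E"
    using assms by (simp add: last_rev hd_conv_nth hd_drop_conv_nth)
qed

lemma ex_longest_distinct_list:
  assumes "finite S" "P p" "\<And>p. P p \<Longrightarrow> distinct p \<and> set p \<subseteq> S"
  shows "\<exists>p. P p \<and> (\<forall>q. P q \<longrightarrow> length q \<le> length p)"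
proof (rule ex_has_greatest_nat[where f = length and b = "Suc (card S)"])
  show "P p" by fact
  show "\<forall>q. P q \<longrightarrow> length q < Suc (card S)"
    by (metis assms(1,3) card_mono distinct_card less_Suc_eq_le)
qed

text \<open>A one-vertex list is a path even if its vertex lies on no edge, hence the inserted
  start; every later vertex ends an edge of the path.\<close>

lemma path_in_vertices:
  assumes "path_in E p"
  shows "set p \<subseteq> insert (p ! 0) (\<Union>E)"
proof
  fix x assume "x \<in> set p"
  then obtain i where i: "i < length p" "x = p ! i" by (metis in_set_conv_nth)
  show "x \<in> insert (p ! 0) (\<Union>E)"
  proof (cases i)
    case 0 then show ?thesis using i by simp
  next
    case (Suc k)
    then have "{p ! k, p ! Suc k} \<in> E" using assms i by (simp add: path_in_def)
    then show ?thesis using i Suc by blast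
  qed
qed

lemma finite_Union_pairs:
  assumes "finite E" "\<forall>e\<in>E. card e = 2"
  shows "finite (\<Union>E)"
proof (rule finite_Union[OF assms(1)])
  show "finite e" if "e \<in> E" for e
    using assms(2) that by (metis card.infinite zero_neq_numeral)
qed

lemma card_2_other:
  assumes "card e = 2" "x \<in> e"
  obtains y where "y \<noteq> x" "e = {x, y}"
  using assms by (metis card_2_iff doubleton_eq_iff insertE singletonD)

section \<open>Components of graphs of maximum degree two\<close>

text \<open>As \<open>u\<close> has degree at most one, its component is a path starting in
  \<open>u\<close>. \<open>K\<close> is the vertex set of a longest path from \<open>u\<close> and
  \<open>l\<close> its last vertex; the vertices strictly between them already have two path
  edges.\<close>

lemma degree_two_component:
  assumes "finite A" "\<forall>e\<in>A. card e = 2"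
    and deg2: "\<And>x. vertex_degree A x \<le> 2" and degu: "vertex_degree A u \<le> 1"
  obtains K l where "u \<in> K" "\<And>f. f \<in> A \<Longrightarrow> f \<inter> K \<noteq> {} \<Longrightarrow> f \<subseteq> K"
    "\<And>x. x \<in> K \<Longrightarrow> x \<noteq> u \<Longrightarrow> vertex_degree A x \<le> 1 \<Longrightarrow> x = l"
proof -
  let ?P = "\<lambda>p. path_in A p \<and> p \<noteq> [] \<and> p ! 0 = u"
  have "\<exists>p. ?P p \<and> (\<forall>q. ?P q \<longrightarrow> length q \<le> length p)"
  proof (rule ex_longest_distinct_list)
    show "finite (insert u (\<Union>A))" using finite_Union_pairs[OF assms(1,2)] by simp
    show "?P [u]" by (simp add: path_in_def)
    show "distinct p \<and> set p \<subseteq> insert u (\<Union>A)" if "?P p" for p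
      using that path_in_vertices[of A p] by (auto simp: path_in_def)
  qed
  then obtain p where p: "path_in A p" "p \<noteq> []" "p ! 0 = u"
    and longest: "\<And>q. ?P q \<Longrightarrow> length q \<le> length p" by blast
  have dist: "distinct p" and step: "\<And>i. Suc i < length p \<Longrightarrow> {p ! i, p ! Suc i} \<in> A"
    using p(1) by (auto simp: path_in_def)
  have inner: "{p ! i, p ! Suc i} \<noteq> {p ! Suc i, p ! Suc (Suc i)}" if "Suc (Suc i) < length p" for i
    using that dist by (auto simp: doubleton_eq_iff nth_eq_iff_index_eq)
  show ?thesis
  proof (rule that)
    show "u \<in> set p" using p by (metis length_greater_0_conv nth_mem)
  next
    fix f assume f: "f \<in> A" "f \<inter> set p \<noteq> {}"
    then obtain i where i: "i < length p" "p ! i \<in> f" by (metis disjoint_iff in_set_conv_nth)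
    obtain y where y: "y \<noteq> p ! i" "f = {p ! i, y}" using card_2_other assms(2) f(1) i(2) by metis
    have "y \<in> set p"
    proof (rule ccontr)
      assume yp: "y \<notin> set p"
      have ends: "f \<noteq> {p ! k, p ! m}" if "k < length p" "m < length p" for k m
        using y yp that by (metis insertCI insertE nth_mem singletonD)
      \<comment> \<open>At the last vertex, \<open>f\<close> would extend \<open>p\<close>; at the
        start, it would be a second edge at \<open>u\<close>; in between, a third edge at
        \<open>p ! i\<close>.\<close>
      consider "Suc i = length p" | "i = 0" "Suc i < length p" | k where "i = Suc k" "Suc i < length p"
        using i(1) by (cases i; cases "Suc i = length p") auto
      then show False
      proof cases
        case 1
        have "path_in A (p @ [y])"
        proof (rule path_in_append)
          show "path_in A [y]" by (simp add: path_in_def)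
          show "{last p, hd [y]} \<in> A" using 1 p(2) f(1) y by (simp add: last_conv_nth flip: 1)
        qed (use p yp in auto)
        then have "length (p @ [y]) \<le> length p"
          using p by (intro longest) (auto simp: nth_append)
        then show False by simp
      next
        case 2
        have "f \<noteq> {p ! 0, p ! Suc 0}" using 2 by (intro ends) auto
        then have "2 \<le> vertex_degree A u"
          using assms(1) f(1) step[of 0] y 2 p(3)
          by (intro vertex_degree_ge_2[of A f "{p ! 0, p ! Suc 0}"]) auto
        then show False using degu by simp
      next
        case 3
        have "3 \<le> vertex_degree A (p ! i)"
          using assms(1) f(1) step[of k] step[of i] ends[of k i] ends[of i "Suc i"] inner[of k] y 3
          by (intro vertex_degree_ge_3[of A f "{p ! k, p ! i}" "{p ! i, p ! Suc i}"]) auto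
        then show False using deg2[of "p ! i"] by simp
      qed
    qed
    then show "f \<subseteq> set p" using y i by auto
  next
    fix x assume x: "x \<in> set p" "x \<noteq> u" "vertex_degree A x \<le> 1"
    then obtain i where i: "i < length p" "x = p ! i" by (metis in_set_conv_nth)
    with x p(3) obtain k where k: "i = Suc k" by (cases i) auto
    show "x = last p"
    proof (rule ccontr)
      assume "x \<noteq> last p"
      then have si: "Suc i < length p" using i p(2)
        by (metis Suc_lessI diff_Suc_1 last_conv_nth)
      have "2 \<le> vertex_degree A x"
        using assms(1) step[of k] step[of i] inner[of k] si k i
        by (intro vertex_degree_ge_2[of A "{p ! k, p ! i}" "{p ! i, p ! Suc i}"]) auto
      then show False using x by simp
    qed
  qed
qed

section \<open>Extending edge colorings\<close>

definition colors_at :: "'a set set \<Rightarrow> ('a set \<Rightarrow> nat) \<Rightarrow> 'a \<Rightarrow> nat set" where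
  "colors_at E c x = c ` {f \<in> E. x \<in> f}"

lemma notin_colors_at: "k \<notin> colors_at E c x \<longleftrightarrow> (\<forall>f\<in>E. x \<in> f \<longrightarrow> c f \<noteq> k)"
  by (auto simp: colors_at_def)

lemma edge_coloring_neq:
  "edge_coloring n E c \<Longrightarrow> e \<in> E \<Longrightarrow> f \<in> E \<Longrightarrow> e \<noteq> f \<Longrightarrow> x \<in> e \<Longrightarrow> x \<in> f \<Longrightarrow> c e \<noteq> c f"
  by (auto simp: edge_coloring_def)

lemma colors_at_subset: "edge_coloring k E c \<Longrightarrow> colors_at E c x \<subseteq> {1..k}"
  by (auto simp: edge_coloring_def colors_at_def)

lemma card_colors_at: "finite E \<Longrightarrow> card (colors_at E c x) \<le> vertex_degree E x"
  by (simp add: colors_at_def vertex_degree_def card_image_le)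

lemma vertex_degree_remove:
  assumes "finite E" "e \<in> E" "x \<in> e"
  shows "vertex_degree (E - {e}) x = vertex_degree E x - 1"
proof -
  have "{f \<in> E - {e}. x \<in> f} = {f \<in> E. x \<in> f} - {e}" by auto
  then show ?thesis using assms by (simp add: vertex_degree_def)
qed

lemma vertex_degree_mono: "finite E \<Longrightarrow> F \<subseteq> E \<Longrightarrow> vertex_degree F x \<le> vertex_degree E x"
  unfolding vertex_degree_def by (intro card_mono) auto

text \<open>The coloring \<open>c\<close> is assumed proper only off the edge \<open>{x, y}\<close>,
  so recoloring an edge is an instance as well as coloring a new one.\<close>

lemma edge_coloring_extend:
  assumes "edge_coloring n (E - {{x, y}}) c" "k \<in> {1..n}"
    and "k \<notin> colors_at (E - {{x, y}}) c x" "k \<notin> colors_at (E - {{x, y}}) c y"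
  shows "edge_coloring n E (c({x, y} := k))"
  unfolding edge_coloring_def
proof (intro conjI ballI impI)
  show "(c({x, y} := k)) ` E \<subseteq> {1..n}"
    using assms(1,2) by (auto simp: edge_coloring_def)
next
  fix e f assume ef: "e \<in> E" "f \<in> E" "e \<noteq> f \<and> e \<inter> f \<noteq> {}"
  have new: "c g \<noteq> k" if "g \<in> E" "g \<noteq> {x, y}" "{x, y} \<inter> g \<noteq> {}" for g
    using that assms(3,4) by (auto simp: colors_at_def)
  have old: "c e \<noteq> c f" if "e \<noteq> {x, y}" "f \<noteq> {x, y}"
    using assms(1) ef that by (auto simp: edge_coloring_def)
  show "(c({x, y} := k)) e \<noteq> (c({x, y} := k)) f"
    using ef old new[of e] new[of f] by (auto simp: Int_commute)
qed

text \<open>Without \<open>{x, y}\<close>, at most (deg x - 1) + (deg y - 1) \<le> 2 colors occur at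
  its ends, so one of three is free at both.\<close>

lemma edge_colorable_light_edge:
  assumes "finite E" "{x, y} \<in> E" "edge_colorable 3 (E - {{x, y}})"
    and "vertex_degree E x + vertex_degree E y \<le> 4"
  shows "edge_colorable 3 E"
proof -
  let ?E = "E - {{x, y}}"
  obtain c where c: "edge_coloring 3 ?E c" using assms(3) by (auto simp: edge_colorable_def)
  \<comment> \<open>Subtraction on \<open>nat\<close> truncates; positive degrees make the two
    bounds add up to at most 2.\<close>
  have pos: "1 \<le> vertex_degree E z" if "z \<in> {x, y}" for z
  proof -
    have "card {{x, y}} \<le> vertex_degree E z"
      unfolding vertex_degree_def using assms(1,2) that by (intro card_mono) auto
    then show ?thesis by simp
  qed
  have bound: "card (colors_at ?E c z) \<le> vertex_degree E z - 1" if "z \<in> {x, y}" for z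
    using card_colors_at[of ?E c z] vertex_degree_remove[OF assms(1,2) that] assms(1) by simp
  have "card (colors_at ?E c x \<union> colors_at ?E c y) \<le> 2"
    using card_Un_le[of "colors_at ?E c x" "colors_at ?E c y"] bound[of x] bound[of y]
      pos[of x] pos[of y] assms(4) by simp
  then have "\<not> {1..3} \<subseteq> colors_at ?E c x \<union> colors_at ?E c y"
    using card_mono[of "colors_at ?E c x \<union> colors_at ?E c y" "{1..3::nat}"] assms(1)
    by (auto simp: colors_at_def)
  then obtain k where "k \<in> {1..3}" "k \<notin> colors_at ?E c x" "k \<notin> colors_at ?E c y" by blast
  then show ?thesis using edge_coloring_extend[OF c] by (auto simp: edge_colorable_def)
qed

text \<open>Recoloring \<open>uw\<close> frees its color for \<open>uv\<close>.\<close>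
lemma edge_coloring_shift:
  assumes c: "edge_coloring n (E - {{u, v}}) c" and "k \<in> {1..n}"
    and uw: "{u, w} \<in> E" "u \<noteq> v" "w \<noteq> v"
    and ku: "k \<notin> colors_at (E - {{u, v}}) c u" and kw: "k \<notin> colors_at (E - {{u, v}}) c w"
    and bv: "c {u, w} \<notin> colors_at (E - {{u, v}}) c v"
  shows "edge_colorable n E"
proof -
  let ?E = "E - {{u, v}}" and ?c = "c({u, w} := k)"
  have uwE: "{u, w} \<in> ?E" using uw by (auto simp: doubleton_eq_iff)
  \<comment> \<open>Forgetting the color of \<open>{u, w}\<close> turns its recoloring into an
    extension.\<close>
  have "edge_coloring n (?E - {{u, w}}) c" using c by (auto simp: edge_coloring_def)
  moreover have "k \<notin> colors_at (?E - {{u, w}}) c u" "k \<notin> colors_at (?E - {{u, w}}) c w"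
    using ku kw by (auto simp: colors_at_def)
  ultimately have c': "edge_coloring n ?E ?c" using edge_coloring_extend \<open>k \<in> {1..n}\<close> by metis
  have bk: "c {u, w} \<noteq> k" using ku uwE by (auto simp: colors_at_def)
  have bn: "c {u, w} \<in> {1..n}"
  proof (rule subsetD)
    show "c ` ?E \<subseteq> {1..n}" using c by (simp only: edge_coloring_def)
    show "c {u, w} \<in> c ` ?E" using uwE by (rule imageI)
  qed
  \<comment> \<open>At \<open>u\<close> the old color of \<open>{u, w}\<close> occurred on that edge
    only, so it is now free there.\<close>
  have "c f \<noteq> c {u, w}" if "f \<in> ?E" "u \<in> f" "f \<noteq> {u, w}" for f
    using edge_coloring_neq[OF c that(1) uwE that(3,2)] by simp
  then have "?c f \<noteq> c {u, w}" if "f \<in> ?E" "u \<in> f" for f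
    using that bk by (cases "f = {u, w}") auto
  then have "c {u, w} \<notin> colors_at ?E ?c u"
    unfolding notin_colors_at by blast
  moreover have "c {u, w} \<notin> colors_at ?E ?c v" using bv uw by (auto simp: colors_at_def)
  ultimately show ?thesis
    using edge_coloring_extend[OF c' bn] by (auto simp: edge_colorable_def)
qed

text \<open>The swap acts on the edges meeting a vertex set \<open>K\<close>. It is a Kempe change
  when \<open>K\<close> is a union of components of the subgraph of edges colored \<open>a\<close>
  or \<open>b\<close>; the assumption \<open>closed\<close> below says this.\<close>

definition kempe_swap :: "'a set \<Rightarrow> nat \<Rightarrow> nat \<Rightarrow> ('a set \<Rightarrow> nat) \<Rightarrow> 'a set \<Rightarrow> nat" where
  "kempe_swap K a b c f =
     (if f \<inter> K = {} then c f else if c f = a then b else if c f = b then a else c f)"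

text \<open>Two adjacent edges with colors in \<open>{a, b}\<close> both meet \<open>K\<close> or
  both avoid it, so they are swapped together or not at all; other colors are unaffected.\<close>

lemma edge_coloring_kempe_swap:
  assumes c: "edge_coloring n E c" and ab: "a \<in> {1..n}" "b \<in> {1..n}"
    and closed: "\<And>f. f \<in> E \<Longrightarrow> c f \<in> {a, b} \<Longrightarrow> f \<inter> K \<noteq> {} \<Longrightarrow> f \<subseteq> K"
  shows "edge_coloring n E (kempe_swap K a b c)"
  unfolding edge_coloring_def
proof (intro conjI ballI impI)
  show "kempe_swap K a b c ` E \<subseteq> {1..n}"
    using c ab by (auto simp: edge_coloring_def kempe_swap_def)
next
  fix e f assume ef: "e \<in> E" "f \<in> E" "e \<noteq> f \<and> e \<inter> f \<noteq> {}"
  then have ne: "c e \<noteq> c f" using c by (auto simp: edge_coloring_def)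
  have "e \<inter> K = {} \<longleftrightarrow> f \<inter> K = {}" if "c e \<in> {a, b}" "c f \<in> {a, b}"
    using closed[OF ef(1) that(1)] closed[OF ef(2) that(2)] ef(3) by blast
  then show "kempe_swap K a b c e \<noteq> kempe_swap K a b c f"
    using ne unfolding kempe_swap_def by (auto split: if_splits)
qed

lemma colors_at_kempe_swap_outside:
  assumes closed: "\<And>f. f \<in> E \<Longrightarrow> c f \<in> {a, b} \<Longrightarrow> f \<inter> K \<noteq> {} \<Longrightarrow> f \<subseteq> K"
    and "x \<notin> K"
  shows "colors_at E (kempe_swap K a b c) x = colors_at E c x"
proof -
  have "kempe_swap K a b c f = c f" if "f \<in> E" "x \<in> f" for f
    using closed[OF that(1)] that assms(2) by (auto simp: kempe_swap_def)
  then show ?thesis by (auto simp: colors_at_def)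
qed

text \<open>Edges at \<open>x\<close> have distinct colors, so counting edges is counting colors.
  This turns the degree conditions of \<open>degree_two_component\<close> into statements about
  color sets.\<close>

lemma vertex_degree_two_colors:
  assumes c: "edge_coloring n E c"
  shows "vertex_degree {f \<in> E. c f \<in> C} x = card (colors_at E c x \<inter> C)"
proof -
  have "inj_on c {e \<in> {f \<in> E. c f \<in> C}. x \<in> e}"
  proof (rule inj_onI, rule ccontr)
    fix e f
    assume "e \<in> {e \<in> {f \<in> E. c f \<in> C}. x \<in> e}" "f \<in> {e \<in> {f \<in> E. c f \<in> C}. x \<in> e}"
      and "c e = c f" "e \<noteq> f"
    then show False using edge_coloring_neq[OF c, of e f x] by simp
  qed
  moreover have "c ` {e \<in> {f \<in> E. c f \<in> C}. x \<in> e} = colors_at E c x \<inter> C"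
    by (auto simp: colors_at_def)
  ultimately show ?thesis unfolding vertex_degree_def by (simp add: card_image[symmetric])
qed

text \<open>If no coloring extends, \<open>v\<close> sees only a color \<open>a\<close>,
  \<open>u\<close> sees the other two, \<open>b\<close> on \<open>{u, w}\<close> and
  \<open>d\<close>, and \<open>w\<close> sees \<open>a\<close> and \<open>b\<close>. So all three
  have degree one in the subgraph of colors \<open>a\<close> and \<open>d\<close>, and the component
  of \<open>u\<close> misses \<open>v\<close> or \<open>w\<close>. Swapping on it frees
  \<open>d\<close> at \<open>u\<close>: color \<open>{u, v}\<close> with \<open>d\<close> if
  \<open>v\<close> is missed; otherwise give \<open>d\<close> to \<open>{u, w}\<close> and
  \<open>b\<close> to \<open>{u, v}\<close>.\<close>

lemma edge_colorable_two_light_neighbors: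
  assumes fin: "finite E" and pairs: "\<forall>e\<in>E. card e = 2"
    and uv: "{u, v} \<in> E" and uw: "{u, w} \<in> E" and dist: "distinct [u, v, w]"
    and deg: "vertex_degree E u \<le> 3" "vertex_degree E v \<le> 2" "vertex_degree E w \<le> 2"
    and col: "edge_colorable 3 (E - {{u, v}})"
  shows "edge_colorable 3 E"
proof (rule ccontr)
  assume neg: "\<not> edge_colorable 3 E"
  let ?E = "E - {{u, v}}"
  obtain c where c: "edge_coloring 3 ?E c" using col by (auto simp: edge_colorable_def)
  have full: "{1..3} \<subseteq> colors_at ?E d u \<union> colors_at ?E d v" if "edge_coloring 3 ?E d" for d
    using edge_coloring_extend[OF that] neg unfolding edge_colorable_def by blast
  have fin': "finite ?E" using fin by simp
  have fc: "finite (colors_at ?E c x)" for x using fin' by (simp add: colors_at_def)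
  have cu: "card (colors_at ?E c u) \<le> 2"
    using card_colors_at[OF fin', of c u] vertex_degree_remove[OF fin uv, of u] deg by simp
  have cv: "card (colors_at ?E c v) \<le> 1"
    using card_colors_at[OF fin', of c v] vertex_degree_remove[OF fin uv, of v] deg by simp
  have cw: "card (colors_at ?E c w) \<le> 2"
    using card_colors_at[OF fin', of c w] vertex_degree_mono[OF fin, of ?E w] deg by simp
  \<comment> \<open>A color free at both ends would extend \<open>c\<close>. So at most 2 colors at
    \<open>u\<close> and at most 1 at \<open>v\<close> cover all three, which forces equality and
    disjointness.\<close>
  have un: "colors_at ?E c u \<union> colors_at ?E c v = {1..3}"
    using full[OF c] colors_at_subset[OF c] by blast
  then have sum: "card (colors_at ?E c u) + card (colors_at ?E c v)
      = 3 + card (colors_at ?E c u \<inter> colors_at ?E c v)"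
    using card_Un_Int[OF fc fc, of u v] by simp
  then have cu2: "card (colors_at ?E c u) = 2" and cv1: "card (colors_at ?E c v) = 1"
    and "card (colors_at ?E c u \<inter> colors_at ?E c v) = 0" using cu cv by linarith+
  then have disj: "colors_at ?E c u \<inter> colors_at ?E c v = {}" using fc by simp
  obtain a where a: "colors_at ?E c v = {a}" using cv1 by (rule card_1_singletonE)
  define b where "b = c {u, w}"
  have uwE: "{u, w} \<in> ?E" using uw dist by (auto simp: doubleton_eq_iff)
  then have bu: "b \<in> colors_at ?E c u" and bw: "b \<in> colors_at ?E c w"
    by (auto simp: b_def colors_at_def)
  obtain d where d: "d \<noteq> b" "colors_at ?E c u = {b, d}" using card_2_other[OF cu2 bu] by metis
  have ne: "a \<noteq> b" "a \<noteq> d" using disj a d by auto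
  have in3: "a \<in> {1..3}" "d \<in> {1..3}" using un a d by auto
  \<comment> \<open>Otherwise \<open>a\<close> is free at \<open>u\<close> and \<open>w\<close>, so
    \<open>{u, w}\<close> can take \<open>a\<close> and leave \<open>b\<close> to
    \<open>{u, v}\<close>.\<close>
  have aw: "a \<in> colors_at ?E c w"
  proof (rule ccontr)
    assume "a \<notin> colors_at ?E c w"
    then have "edge_colorable 3 E"
      using edge_coloring_shift[OF c in3(1) uw] dist ne d a by (auto simp: b_def)
    then show False using neg by simp
  qed
  have "{a, b} = colors_at ?E c w" using aw bw fc cw ne by (intro card_seteq) auto
  then have w: "colors_at ?E c w = {a, b}" by simp
  define A where "A = {f \<in> ?E. c f \<in> {a, d}}"
  have degA: "vertex_degree A x = card (colors_at ?E c x \<inter> {a, d})" for x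
    unfolding A_def by (rule vertex_degree_two_colors[OF c])
  have "vertex_degree A x \<le> 2" for x
    using card_mono[of "{a, d}" "colors_at ?E c x \<inter> {a, d}"] ne by (simp add: degA)
  moreover have "vertex_degree A u \<le> 1" using d ne by (simp add: degA)
  moreover have "finite A" "\<forall>e\<in>A. card e = 2" using fin pairs by (auto simp: A_def)
  ultimately obtain K l where K: "u \<in> K" "\<And>f. f \<in> A \<Longrightarrow> f \<inter> K \<noteq> {} \<Longrightarrow> f \<subseteq> K"
    and l: "\<And>x. x \<in> K \<Longrightarrow> x \<noteq> u \<Longrightarrow> vertex_degree A x \<le> 1 \<Longrightarrow> x = l"
    using degree_two_component by metis
  have closed: "f \<subseteq> K" if "f \<in> ?E" "c f \<in> {a, d}" "f \<inter> K \<noteq> {}" for f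
    using K(2)[of f] that by (simp add: A_def)
  define c' where "c' = kempe_swap K a d c"
  have c': "edge_coloring 3 ?E c'"
    unfolding c'_def using c in3 closed by (rule edge_coloring_kempe_swap)
  have out: "colors_at ?E c' x = colors_at ?E c x" if "x \<notin> K" for x
    unfolding c'_def using closed that by (rule colors_at_kempe_swap_outside)
  have du: "d \<notin> colors_at ?E c' u"
  proof
    assume "d \<in> colors_at ?E c' u"
    then obtain f where f: "f \<in> ?E" "u \<in> f" "c' f = d" by (auto simp: colors_at_def)
    then have "c f = a" using K(1) ne by (auto simp: c'_def kempe_swap_def split: if_splits)
    then have "a \<in> colors_at ?E c u" using f by (auto simp: colors_at_def)
    then show False using d ne by simp
  qed
  have "vertex_degree A v \<le> 1" "vertex_degree A w \<le> 1" using a w ne d(1) by (simp_all add: degA)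
  then have "v \<notin> K \<or> w \<notin> K" using l[of v] l[of w] dist by auto
  then show False
  proof
    assume "v \<notin> K"
    then have "d \<notin> colors_at ?E c' v" using out a ne by simp
    then show False using du full[OF c'] in3 by auto
  next
    assume "w \<notin> K"
    then have dw: "d \<notin> colors_at ?E c' w" using out w ne d by simp
    \<comment> \<open>Even if \<open>v\<close> lies in \<open>K\<close>, its colored edges only
      change from \<open>a\<close> to \<open>d\<close>, so \<open>b\<close> stays free at
      \<open>v\<close>.\<close>
    have "c' f \<noteq> b" if "f \<in> ?E" "v \<in> f" for f
    proof -
      have "c f = a" using that a by (auto simp: colors_at_def)
      then show ?thesis using ne d(1) by (auto simp: c'_def kempe_swap_def)
    qed
    moreover have "c' {u, w} = b" using ne d(1) by (auto simp: c'_def kempe_swap_def b_def)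
    ultimately have "c' {u, w} \<notin> colors_at ?E c' v"
      unfolding notin_colors_at by blast
    then have "edge_colorable 3 E"
      using edge_coloring_shift[OF c' in3(2) uw _ _ du dw] dist by auto
    then show False using neg by simp
  qed
qed

section \<open>Longest paths\<close>

definition longest_path :: "'a set set \<Rightarrow> 'a list \<Rightarrow> bool" where
  "longest_path E p \<longleftrightarrow> path_in E p \<and> (\<forall>q. path_in E q \<longrightarrow> length q \<le> length p)"

lemma longest_path_rev: "longest_path E p \<Longrightarrow> longest_path E (rev p)"
  by (simp add: longest_path_def path_in_rev)

lemma longest_path_rotate:
  assumes "longest_path E p" "0 < j" "j < length p" "{p ! 0, p ! j} \<in> E"
  shows "longest_path E (rev (take j p) @ drop j p)" "(rev (take j p) @ drop j p) ! 0 = p ! (j - 1)"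
  using assms path_in_rotate[of E p j] by (auto simp: longest_path_def nth_append rev_nth)

lemma ex_longest_path:
  assumes "finite E" "\<forall>e\<in>E. card e = 2" "E \<noteq> {}"
  obtains p where "longest_path E p" "2 \<le> length p"
proof -
  obtain e where "e \<in> E" using assms(3) by blast
  then obtain x y where xy: "e = {x, y}" "x \<noteq> y" using assms(2) by (meson card_2_iff)
  \<comment> \<open>Requiring two vertices keeps the competing paths inside the finite set
    \<open>\<Union>E\<close>; shorter lists cannot beat them anyway.\<close>
  let ?P = "\<lambda>p. path_in E p \<and> 2 \<le> length p"
  have P: "?P [x, y]" using xy \<open>e \<in> E\<close> by (auto simp: path_in_def)
  have "\<exists>p. ?P p \<and> (\<forall>q. ?P q \<longrightarrow> length q \<le> length p)"
  proof (rule ex_longest_distinct_list)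
    show "finite (\<Union>E)" using finite_Union_pairs[OF assms(1,2)] .
    show "?P [x, y]" by fact
    fix p assume p: "?P p"
    then have "{p ! 0, p ! Suc 0} \<in> E" by (simp add: path_in_def)
    then have "p ! 0 \<in> \<Union>E" by blast
    then show "distinct p \<and> set p \<subseteq> \<Union>E"
      using p path_in_vertices[of E p] by (auto simp: path_in_def)
  qed
  then obtain p where p: "?P p" "\<And>q. ?P q \<Longrightarrow> length q \<le> length p" by blast
  have "length q \<le> length p" if "path_in E q" for q
    using that p by (cases "2 \<le> length q") auto
  then show ?thesis using that p(1) by (auto simp: longest_path_def)
qed

lemma longest_path_neighbor:
  assumes "longest_path E p" "p \<noteq> []" "{p ! 0, y} \<in> E"
  shows "y \<in> set p"
proof (rule ccontr)
  assume "y \<notin> set p"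
  have "path_in E ([y] @ p)"
  proof (rule path_in_append)
    show "path_in E [y]" by (simp add: path_in_def)
  qed (use assms \<open>y \<notin> set p\<close> in \<open>auto simp: longest_path_def hd_conv_nth insert_commute\<close>)
  then have "length ([y] @ p) \<le> length p" using assms(1) unfolding longest_path_def by blast
  then show False by simp
qed

text \<open>All neighbors of the start lie on the path, since another one could be prepended. Hence
  edges at the start can be counted by positions.\<close>

lemma longest_path_degree:
  assumes p: "longest_path E p" "2 \<le> length p" and pairs: "\<forall>e\<in>E. card e = 2"
  shows "vertex_degree E (p ! 0) = card {i. 0 < i \<and> i < length p \<and> {p ! 0, p ! i} \<in> E}" (is "_ = card ?N")
proof -
  have dist: "distinct p" using p(1) by (simp add: longest_path_def path_in_def)
  have "bij_betw (\<lambda>i. {p ! 0, p ! i}) ?N {e \<in> E. p ! 0 \<in> e}"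
  proof (rule bij_betw_imageI)
    show "inj_on (\<lambda>i. {p ! 0, p ! i}) ?N"
    proof (rule inj_onI)
      fix i k assume "i \<in> ?N" "k \<in> ?N" "{p ! 0, p ! i} = {p ! 0, p ! k}"
      then have "p ! i = p ! k" "i < length p" "k < length p" by (auto simp: doubleton_eq_iff)
      then show "i = k" using dist by (simp add: nth_eq_iff_index_eq)
    qed
    show "(\<lambda>i. {p ! 0, p ! i}) ` ?N = {e \<in> E. p ! 0 \<in> e}"
    proof (intro subset_antisym subsetI)
      fix e assume e: "e \<in> {e \<in> E. p ! 0 \<in> e}"
      obtain y where y: "y \<noteq> p ! 0" "e = {p ! 0, y}"
        by (rule card_2_other[of e "p ! 0"]) (use e pairs in auto)
      have "p \<noteq> []" using p(2) by auto
      then have "y \<in> set p" using longest_path_neighbor[OF p(1), of y] e y by simp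
      then obtain i where "i < length p" "y = p ! i" by (metis in_set_conv_nth)
      moreover from this y have "0 < i" by (metis gr0I)
      ultimately show "e \<in> (\<lambda>i. {p ! 0, p ! i}) ` ?N" using y(2) e by (intro image_eqI[of _ _ i]) simp_all
    qed auto
  qed
  then have "card ?N = card {e \<in> E. p ! 0 \<in> e}" by (rule bij_betw_same_card)
  then show ?thesis by (simp add: vertex_degree_def)
qed

text \<open>The edge to \<open>p ! j\<close> closes the initial segment to a cycle; 1 < i < j makes
  the edge to \<open>p ! i\<close> neither a path edge nor the closing one.\<close>

lemma path_chord:
  assumes p: "path_in E p" and ij: "1 < i" "i < j" "j < length p"
    and e: "{p ! 0, p ! i} \<in> E" "{p ! 0, p ! j} \<in> E"
  shows "\<exists>q. graph_cycle E q \<and> is_chord E q {p ! 0, p ! i}"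
proof (intro exI conjI)
  let ?q = "take (Suc j) p"
  have len: "length ?q = Suc j" using ij by simp
  have dist: "distinct p" and step: "\<And>i. Suc i < length p \<Longrightarrow> {p ! i, p ! Suc i} \<in> E"
    using p by (auto simp: path_in_def)
  \<comment> \<open>Only at m = j does the index wrap around, giving the closing edge.\<close>
  have edge: "{?q ! m, ?q ! (Suc m mod Suc j)} = (if m = j then {p ! j, p ! 0} else {p ! m, p ! Suc m})"
    if "m < Suc j" for m
    using that by auto
  have edges: "cycle_edges ?q = {(if m = j then {p ! j, p ! 0} else {p ! m, p ! Suc m}) | m. m < Suc j}"
    unfolding cycle_edges_def len using edge by blast
  have "cycle_edges ?q \<subseteq> E"
    unfolding edges using e(2) step ij by (auto simp: insert_commute)
  then show "graph_cycle E ?q"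
    using len ij dist by (simp add: graph_cycle_def)
  have "p \<noteq> []" using ij by auto
  have "p ! 0 \<in> set ?q" "p ! i \<in> set ?q" using nth_mem[of 0 ?q] nth_mem[of i ?q] ij by (simp_all add: len)
  moreover have "{p ! 0, p ! i} \<notin> cycle_edges ?q"
  proof -
    have "{p ! 0, p ! i} \<noteq> {p ! j, p ! 0}"
      using ij dist \<open>p \<noteq> []\<close> by (simp add: doubleton_eq_iff nth_eq_iff_index_eq)
    moreover have "{p ! 0, p ! i} \<noteq> {p ! m, p ! Suc m}" if "m < j" for m
    proof -
      have "p ! i \<noteq> p ! 0" "p ! 0 = p ! m \<longleftrightarrow> m = 0" "p ! i = p ! Suc m \<longleftrightarrow> i = Suc m"
        "p ! 0 \<noteq> p ! Suc m"
        using that ij dist \<open>p \<noteq> []\<close> by (simp_all add: nth_eq_iff_index_eq)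
      moreover have "\<not> (m = 0 \<and> i = Suc m)" using ij by auto
      ultimately show ?thesis by (simp only: doubleton_eq_iff) blast
    qed
    ultimately have "{p ! 0, p ! i} \<noteq> (if m = j then {p ! j, p ! 0} else {p ! m, p ! Suc m})"
      if "m < Suc j" for m
      using that by (simp only: less_Suc_eq split: if_split) blast
    then show ?thesis unfolding edges by blast
  qed
  ultimately show "is_chord E ?q {p ! 0, p ! i}" using e(1) by (simp add: is_chord_def)
qed

text \<open>The candidates for \<open>v\<close> and \<open>w\<close> are starts of longest paths,
  related by a rotation. Only the two ends of the chord can be such starts without having degree
  two, and passing to the reversed path avoids both.\<close>

lemma ex_two_light_neighbors:
  fixes E :: "'a set set"
  assumes fin: "finite E" and pairs: "\<forall>e\<in>E. card e = 2" and "E \<noteq> {}"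
    and deg3: "\<And>x. vertex_degree E x \<le> 3" and deg2: "\<And>x. x \<in> \<Union>E \<Longrightarrow> 2 \<le> vertex_degree E x"
    and ac: "almost_chordless E"
  obtains u v w where "distinct [u, v, w]" "{u, v} \<in> E" "{u, w} \<in> E"
    "vertex_degree E v = 2" "vertex_degree E w = 2"
proof -
  note config = that
  let ?chord = "\<lambda>e. \<exists>q. graph_cycle E q \<and> is_chord E q e"
  define N where "N p = {i. 0 < i \<and> i < length p \<and> {p ! 0, p ! i} \<in> E}" for p :: "'a list"
  obtain p0 where p0: "longest_path E p0" "2 \<le> length p0" using ex_longest_path[OF fin pairs \<open>E \<noteq> {}\<close>] .
  have len: "2 \<le> length p" if "longest_path E p" for p
    using that p0 unfolding longest_path_def by (meson order_trans)
  have N1: "1 \<in> N p" if "longest_path E p" for p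
    using that len[OF that] by (auto simp: N_def longest_path_def path_in_def)
  have degN: "vertex_degree E (p ! 0) = card (N p)" if "longest_path E p" for p
    using longest_path_degree[OF that len[OF that] pairs] by (simp add: N_def)
  have N2: "\<exists>j\<in>N p. 2 \<le> j" if "longest_path E p" for p
  proof (rule ccontr)
    assume "\<not> ?thesis"
    then have "N p \<subseteq> {1}" by (force simp: N_def)
    then have "card (N p) \<le> 1" using card_mono[of "{1}" "N p"] by simp
    moreover have "p ! 0 \<in> \<Union>E" using N1[OF that] by (auto simp: N_def)
    ultimately show False using deg2 degN[OF that] by fastforce
  qed
  \<comment> \<open>\<open>N p\<close> contains 1 and some k \<ge> 2; as its size is not 2, it has a
    third element. The two elements above 1 are what \<open>path_chord\<close> needs.\<close>
  have start: "\<exists>i j. 1 < i \<and> i < j \<and> i \<in> N p \<and> j \<in> N p"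
    if p: "longest_path E p" "vertex_degree E (p ! 0) \<noteq> 2" for p
  proof -
    obtain k where k: "k \<in> N p" "2 \<le> k" using N2[OF p(1)] by blast
    have "N p \<noteq> {1, k}" using degN[OF p(1)] p(2) k by auto
    then obtain m where m: "m \<in> N p" "m \<noteq> 1" "m \<noteq> k" using N1[OF p(1)] k by blast
    then have "1 < m" by (simp add: N_def)
    then show ?thesis using k m by (metis linorder_neqE_nat less_eq_Suc_le numeral_2_eq_2 One_nat_def)
  qed
  have rot: "\<exists>q. longest_path E q \<and> q ! 0 = p ! (j - 1)" if "longest_path E p" "j \<in> N p" for p j
    using longest_path_rotate[OF that(1), of j] that(2) by (auto simp: N_def)
  \<comment> \<open>Here \<open>p ! j\<close> serves as \<open>u\<close>, with \<open>p ! 0\<close>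
    and \<open>p ! (j - 1)\<close> as its light neighbors; j \<ge> 2 keeps these apart.\<close>
  have conf: thesis if p: "longest_path E p" "j \<in> N p" "2 \<le> j"
    "vertex_degree E (p ! 0) = 2" "vertex_degree E (p ! (j - 1)) = 2" for p j
  proof -
    have dist: "distinct p" using p(1) by (simp add: longest_path_def path_in_def)
    have "p \<noteq> []" "j < length p" "{p ! 0, p ! j} \<in> E" using p(2) by (auto simp: N_def)
    moreover have "{p ! (j - 1), p ! Suc (j - 1)} \<in> E"
      using p(1,3) \<open>j < length p\<close> unfolding longest_path_def path_in_def
      by (metis Suc_pred' bot_nat_0.not_eq_extremum not_numeral_le_zero)
    ultimately show thesis
      using p dist by (intro config[of "p ! j" "p ! 0" "p ! (j - 1)"])
        (auto simp: nth_eq_iff_index_eq insert_commute)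
  qed
  show thesis
    \<comment> \<open>If some longest path starts in a vertex of degree three, its reverse has the required end.\<close>
  proof (cases "\<forall>p. longest_path E p \<longrightarrow> vertex_degree E (p ! 0) = 2")
    case True
    obtain j where "j \<in> N p0" "2 \<le> j" using N2[OF p0(1)] by blast
    then show thesis using conf[OF p0(1), of j] rot[OF p0(1), of j] True p0(1) by metis
  next
    case False
    then obtain p i j where p: "longest_path E p" and ij: "1 < i" "i < j" "i \<in> N p" "j \<in> N p"
      using start by blast
    have dist: "distinct p" and step: "\<And>i. Suc i < length p \<Longrightarrow> {p ! i, p ! Suc i} \<in> E"
      using p by (auto simp: longest_path_def path_in_def)
    have jl: "p \<noteq> []" "j < length p" using ij by (auto simp: N_def)
    have chord_p: "?chord {p ! 0, p ! i}"
      using path_chord[of E p i j] p ij by (simp add: N_def longest_path_def)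
    \<comment> \<open>Another degree would yield a chord at \<open>q ! 0\<close>, which by
      uniqueness is the chord from \<open>p ! 0\<close> to \<open>p ! i\<close>.\<close>
    have light: "vertex_degree E (q ! 0) = 2"
      if q: "longest_path E q" "q ! 0 \<noteq> p ! 0" "q ! 0 \<noteq> p ! i" for q
    proof (rule ccontr)
      assume "vertex_degree E (q ! 0) \<noteq> 2"
      then obtain k m where "1 < k" "k < m" "k \<in> N q" "m \<in> N q" using start[OF q(1)] by blast
      then have "?chord {q ! 0, q ! k}"
        using path_chord[of E q k m] q(1) by (simp add: N_def longest_path_def)
      then have "{q ! 0, q ! k} = {p ! 0, p ! i}"
        using ac chord_p unfolding almost_chordless_def Uniq_def by blast
      then show False using q by (auto simp: doubleton_eq_iff)
    qed
    define q n where "q = rev p" and "n = length p - 1"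
    have q: "longest_path E q" unfolding q_def by (rule longest_path_rev[OF p])
    have qn: "q ! k = p ! (n - k)" if "k \<le> n" for k
      using that jl by (simp add: q_def n_def rev_nth)
    have nj: "j \<le> n" "n < length p" using jl by (auto simp: n_def)
    have q0: "q ! 0 = p ! n" by (simp add: qn)
    obtain k where k: "k \<in> N q" "2 \<le> k" using N2[OF q] by blast
    have kn: "k \<le> n" using k by (auto simp: N_def q_def n_def)
    have qk: "q ! (k - 1) = p ! (n - k + 1)" using qn[of "k - 1"] kn k by (simp add: Suc_diff_le)
    \<comment> \<open>The start \<open>p ! n\<close> of \<open>q\<close> is no end of the chord,
      because i < j \<le> n.\<close>
    have "vertex_degree E (q ! 0) = 2"
      using light[OF q] q0 nj ij jl dist by (simp add: nth_eq_iff_index_eq)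
    moreover have "vertex_degree E (q ! (k - 1)) = 2"
    \<comment> \<open>The rotated start \<open>p ! (n - k + 1)\<close> is not \<open>p ! 0\<close>,
      so if heavy it is \<open>p ! i\<close>, and \<open>p ! n\<close> is adjacent to
      \<open>p ! (i - 1)\<close>. The latter starts a longest path by rotating \<open>p\<close>
      along its chord, so it has degree two, yet it is also adjacent to \<open>p ! (i - 2)\<close>
      and \<open>p ! i\<close>.\<close>
    proof (rule ccontr)
      assume heavy: "vertex_degree E (q ! (k - 1)) \<noteq> 2"
      obtain r where r: "longest_path E r" "r ! 0 = p ! (n - k + 1)"
        using rot[OF q k(1)] qk by metis
      have "p ! (n - k + 1) \<noteq> p ! 0" using nj kn k jl dist by (simp add: nth_eq_iff_index_eq)
      then have "p ! (n - k + 1) = p ! i" using light[OF r(1)] heavy r(2) qk by metis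
      then have nk: "n - k + 1 = i" using nj kn k ij jl dist by (simp add: nth_eq_iff_index_eq)
      then have ik: "n - k = i - 1" by simp
      obtain s where s: "longest_path E s" "s ! 0 = p ! (i - 1)" using rot[OF p ij(3)] by blast
      have "vertex_degree E (p ! (i - 1)) = 2"
        using light[OF s(1)] s(2) ij jl dist by (simp add: nth_eq_iff_index_eq)
      moreover have "3 \<le> vertex_degree E (p ! (i - 1))"
      proof (rule vertex_degree_ge_3[OF fin])
        have "{p ! n, p ! (i - 1)} \<in> E" using k q0 qn[OF kn] ik by (simp add: N_def)
        moreover have "{p ! (i - 2), p ! (i - 1)} \<in> E"
          using step[of "i - 2"] ij jl by (simp add: numeral_2_eq_2 Suc_diff_Suc)
        moreover have "{p ! (i - 1), p ! i} \<in> E" using step[of "i - 1"] ij jl by simp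
        ultimately show "{{p ! n, p ! (i - 1)}, {p ! (i - 2), p ! (i - 1)}, {p ! (i - 1), p ! i}} \<subseteq> E"
          by simp
        have "p ! n \<noteq> p ! (i - 2)" "p ! n \<noteq> p ! i" "p ! (i - 2) \<noteq> p ! i"
          using ij nj jl dist by (simp_all add: nth_eq_iff_index_eq)
        then show "distinct [{p ! n, p ! (i - 1)}, {p ! (i - 2), p ! (i - 1)}, {p ! (i - 1), p ! i}]"
          by (auto simp: doubleton_eq_iff)
      qed auto
      ultimately show False by simp
    qed
    ultimately show thesis using conf[OF q k] by blast
  qed
qed

section \<open>Induction on the number of edges\<close>

lemma almost_chordless_mono:
  assumes "almost_chordless E" "F \<subseteq> E"
  shows "almost_chordless F"
proof -
  have "\<exists>q. graph_cycle E q \<and> is_chord E q e" if "\<exists>q. graph_cycle F q \<and> is_chord F q e" for e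
    using that assms(2) unfolding graph_cycle_def is_chord_def by blast
  then show ?thesis using assms(1) unfolding almost_chordless_def Uniq_def by blast
qed

text \<open>The degree bound is an inequality so that it survives the deletion of an edge.\<close>

lemma almost_chordless_subcubic_edge_colorable:
  assumes "finite E" "\<forall>e\<in>E. card e = 2" "\<And>x. vertex_degree E x \<le> 3" "almost_chordless E"
  shows "edge_colorable 3 E"
  using assms
proof (induction "card E" arbitrary: E rule: less_induct)
  case less
  note fin = less.prems(1) and pairs = less.prems(2) and deg3 = less.prems(3)
  have smaller: "edge_colorable 3 (E - {e})" if "e \<in> E" for e
  proof (rule less.hyps)
    show "card (E - {e}) < card E" using fin that by (rule card_Diff1_less)
    show "vertex_degree (E - {e}) x \<le> 3" for x
      using vertex_degree_mono[OF fin, of "E - {e}" x] deg3[of x] by simp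
    show "almost_chordless (E - {e})" using almost_chordless_mono[OF less.prems(4)] by simp
  qed (use fin pairs in auto)
  consider "E = {}" | x where "x \<in> \<Union>E" "vertex_degree E x < 2"
    | "E \<noteq> {}" "\<And>x. x \<in> \<Union>E \<Longrightarrow> 2 \<le> vertex_degree E x"
    by (meson not_le)
  then show ?case
  proof cases
    case 1
    then show ?thesis by (simp add: edge_colorable_def edge_coloring_def)
  next
    case 2
    then obtain e where "e \<in> E" "x \<in> e" by blast
    then obtain y where "e = {x, y}" using card_2_other pairs by metis
    \<comment> \<open>The degrees of \<open>x\<close> and \<open>y\<close> are at most 1 and 3,
      within the bound 4 for a light edge.\<close>
    then show ?thesis
      using edge_colorable_light_edge[OF fin, of x y] smaller \<open>e \<in> E\<close> 2 deg3[of y] by simp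
  next
    case 3
    then obtain u v w where "distinct [u, v, w]" "{u, v} \<in> E" "{u, w} \<in> E"
      "vertex_degree E v = 2" "vertex_degree E w = 2"
      using ex_two_light_neighbors[OF fin pairs _ deg3 _ less.prems(4)] by metis
    then show ?thesis
      using edge_colorable_two_light_neighbors[OF fin pairs, of u v w] smaller deg3[of u] by simp
  qed
qed

theorem theorem4p1:
  fixes V :: "'a set" and E :: "'a set set"
  assumes "fin_simple_graph V E"
    and "almost_chordless E"
    and "max_degree V E = 3"
  shows "edge_colorable 3 E"
proof (rule almost_chordless_subcubic_edge_colorable)
  have V: "finite V" "E \<subseteq> Pow V" and pairs: "\<forall>e\<in>E. card e = 2"
    using assms(1) by (auto simp: fin_simple_graph_def)
  show "finite E" using V by (meson finite_Pow_iff finite_subset)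
  show "\<forall>e\<in>E. card e = 2" by fact
  show "almost_chordless E" by fact
  show "vertex_degree E x \<le> 3" for x
  proof (cases "x \<in> V")
    case True
    then show ?thesis using assms(3) V(1) unfolding max_degree_def
      by (metis Max_ge finite_imageI finite_insert image_eqI insertI2)
  next
    \<comment> \<open>The induction bounds degrees over the whole type; a vertex outside
      \<open>V\<close> lies on no edge.\<close>
    case False
    then have none: "{e \<in> E. x \<in> e} = {}" using V(2) by auto
    show ?thesis unfolding vertex_degree_def none by simp
  qed
qed

end
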